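(* Let $C$ be a normal closed cone with nonempty interior $C^\circ$ in a real Banach space $(X,\|\cdot\|)$, and let $f\colon C^\circ\to C^\circ$ be a fixed point free mapping which is nonexpansive under Thompson's metric $d_C$ and satisfies the fixed point property on $C^\circ$ with respect to $d_C$. If $\mathcal{O}(x_0;f)$ has compact closure in the norm topology for some $x_0\in C^\circ$, then there exists a convex set $\Omega\subseteq\partial C$ such that $\omega(x;f)\subseteq\Omega$ for all $x\in C^\circ$.
   Context: A cone $C\subseteq X$ is a convex set with $C\cap(-C)=\{0\}$ and $\lambda C\subseteq C$ for all $\lambda\ge 0$; $x\le_C y$ means $y-x\in C$. $C$ is normal if there is $\kappa\ge 0$ with $\|x\|\le\kappa\|y\|$ whenever $0\le_C x\le_C y$. For $x,y\in C^\circ$ let $M(x/y)=\inf\{\beta\in\mathbb{R}\colon x\le_C\beta y\}$; Thompson's metric on $C^\circ$ is $d_C(x,y)=\log\max\{M(x/y),M(y/x)\}$. Nonexpansive means $d_C(f(x),f(y))\le d_C(x,y)$ for all $x,y\in C^\circ$. A continuous map $f\colon C^\circ\to C^\circ$ has the fixed point property on $C^\circ$ with respect to $d_C$ if for each nonempty, bounded, convex, closed subset $D$ of $(C^\circ,d_C)$ with $f(D)\subseteq D$, $f$ has a fixed point in $D$. $\mathcal{O}(x;f)=\{f^k(x)\colon k\ge0\}$, and $\omega(x;f)$ is the set of all limits in the norm topology of subsequences $(f^{k_i}(x))_i$ with $k_i\to\infty$. *)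

theory Defs
  imports "HOL-Analysis.Analysis"
begin

text \<open>The constant \<open>cone\<close> of \<open>HOL-Analysis\<close> does not demand convexity or pointedness.\<close>

definition ordering_cone :: "'a::real_vector set \<Rightarrow> bool" where
  "ordering_cone C \<longleftrightarrow>
     convex C \<and> C \<inter> uminus ` C = {0} \<and> (\<forall>c\<ge>0. (\<lambda>x. c *\<^sub>R x) ` C \<subseteq> C)"

definition cone_le :: "'a::real_vector set \<Rightarrow> 'a \<Rightarrow> 'a \<Rightarrow> bool" where
  "cone_le C x y \<longleftrightarrow> y - x \<in> C"

definition normal_cone :: "'a::real_normed_vector set \<Rightarrow> bool" where
  "normal_cone C \<longleftrightarrow>
     (\<exists>\<kappa>\<ge>0. \<forall>x y. cone_le C 0 x \<and> cone_le C x y \<longrightarrow> norm x \<le> \<kappa> * norm y)"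

definition cone_M :: "'a::real_vector set \<Rightarrow> 'a \<Rightarrow> 'a \<Rightarrow> real" where
  "cone_M C x y = Inf {\<beta>. cone_le C x (\<beta> *\<^sub>R y)}"

text \<open>Thompson's metric lives on \<open>interior C\<close>. The value 0 elsewhere is a dummy: the locale
  \<open>Metric_space\<close> wants nonnegativity and symmetry on the whole type.\<close>

definition thompson :: "'a::real_normed_vector set \<Rightarrow> 'a \<Rightarrow> 'a \<Rightarrow> real" where
  "thompson C x y =
     (if x \<in> interior C \<and> y \<in> interior C then ln (max (cone_M C x y) (cone_M C y x)) else 0)"

definition thompson_nonexpansive :: "'a::real_normed_vector set \<Rightarrow> ('a \<Rightarrow> 'a) \<Rightarrow> bool" where
  "thompson_nonexpansive C f \<longleftrightarrow>
     (\<forall>x\<in>interior C. \<forall>y\<in>interior C. thompson C (f x) (f y) \<le> thompson C x y)"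

abbreviation thompson_topology :: "'a::real_normed_vector set \<Rightarrow> 'a topology" where
  "thompson_topology C \<equiv> Metric_space.mtopology (interior C) (thompson C)"

text \<open>Boundedness and closedness of \<open>D\<close> refer to the metric space \<open>(interior C, thompson C)\<close>,
  convexity to the ambient vector space. The continuity conjunct records that the property is
  only defined for continuous self-maps; it is automatic for nonexpansive ones.\<close>

definition thompson_fpp :: "'a::real_normed_vector set \<Rightarrow> ('a \<Rightarrow> 'a) \<Rightarrow> bool" where
  "thompson_fpp C f \<longleftrightarrow>
     continuous_map (thompson_topology C) (thompson_topology C) f \<and>
     (\<forall>D. D \<noteq> {} \<and> Metric_space.mbounded (interior C) (thompson C) D \<and> convex D \<and>
          closedin (thompson_topology C) D \<and> f ` D \<subseteq> D
          \<longrightarrow> (\<exists>x\<in>D. f x = x))"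

definition orbit_set :: "('a \<Rightarrow> 'a) \<Rightarrow> 'a \<Rightarrow> 'a set" where
  "orbit_set f x = {(f ^^ k) x |k. True}"

definition omega_limit_set :: "('a::real_normed_vector \<Rightarrow> 'a) \<Rightarrow> 'a \<Rightarrow> 'a set" where
  "omega_limit_set f x = {y. \<exists>k. strict_mono k \<and> (\<lambda>i. (f ^^ k i) x) \<longlonglongrightarrow> y}"

text \<open>The locale assumption behind the topological notions above. The hypothesis
  \<open>0 \<notin> interior C\<close> only excludes the zero space.\<close>

lemma ordering_coneD:
  assumes "ordering_cone C"
  shows "0 \<in> C" "x \<in> C \<Longrightarrow> c \<ge> 0 \<Longrightarrow> c *\<^sub>R x \<in> C" "x \<in> C \<Longrightarrow> y \<in> C \<Longrightarrow> x + y \<in> C"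
    "x \<in> C \<Longrightarrow> - x \<in> C \<Longrightarrow> x = 0"
proof -
  have sc: "c *\<^sub>R x \<in> C" if "x \<in> C" "c \<ge> 0" for x c
    using assms that unfolding ordering_cone_def by blast
  show "0 \<in> C" using assms unfolding ordering_cone_def by blast
  show "x \<in> C \<Longrightarrow> c \<ge> 0 \<Longrightarrow> c *\<^sub>R x \<in> C" using sc .
  show "x + y \<in> C" if "x \<in> C" "y \<in> C"
  proof -
    have "convex C" using assms unfolding ordering_cone_def by blast
    then have "(1/2) *\<^sub>R x + (1/2) *\<^sub>R y \<in> C"
      using that by (simp add: convex_def)
    from sc[OF this, of 2] show ?thesis by (simp add: scaleR_add_right)
  qed
  show "x = 0" if "x \<in> C" "- x \<in> C"
  proof -
    have "x \<in> uminus ` C" using that(2) by (metis image_eqI minus_minus)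
    then show ?thesis using assms that(1) unfolding ordering_cone_def by blast
  qed
qed

lemma cone_M_interior:
  fixes C :: "'a::real_normed_vector set"
  assumes C: "ordering_cone C" "closed C" "0 \<notin> interior C"
    and x: "x \<in> interior C" and y: "y \<in> interior C"
  shows "0 < cone_M C x y" "cone_M C x y *\<^sub>R y - x \<in> C"
    "\<And>b. b *\<^sub>R y - x \<in> C \<Longrightarrow> cone_M C x y \<le> b"
proof -
  note D = ordering_coneD[OF C(1)]
  let ?S = "{b. b *\<^sub>R y - x \<in> C}"
  have xC: "x \<in> C" and yC: "y \<in> C" using x y interior_subset by auto
  have x0: "x \<noteq> 0" using x C by auto
  have pos: "0 < b" if "b \<in> ?S" for b
  proof (rule ccontr)
    assume "\<not> 0 < b"
    then have "(- b) *\<^sub>R y \<in> C" using D(2)[OF yC, of "- b"] by simp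
    then have "(b *\<^sub>R y - x) + (- b) *\<^sub>R y \<in> C" using that D(3) by blast
    then have "- x \<in> C" by simp
    then show False using D(4) xC x0 by blast
  qed
  obtain e where e: "e > 0" "ball y e \<subseteq> C" using y mem_interior by metis
  define t where "t = e / (2 * norm x)"
  have t: "t > 0" using e x0 by (simp add: t_def)
  have "norm (t *\<^sub>R x) < e" using e x0 by (simp add: t_def)
  then have "y - t *\<^sub>R x \<in> C" using e by (auto simp: dist_norm)
  then have "(1/t) *\<^sub>R (y - t *\<^sub>R x) \<in> C" using D(2) t by simp
  then have ne: "1/t \<in> ?S" using t by (simp add: scaleR_diff_right)
  have bdd: "bdd_below ?S" using pos by (meson bdd_belowI less_imp_le)
  have "closed ?S"
  proof -
    have "?S = (\<lambda>b. b *\<^sub>R y - x) -` C" by auto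
    moreover have "isCont (\<lambda>b. b *\<^sub>R y - x) b" for b by (intro continuous_intros)
    ultimately show ?thesis
      using continuous_closed_vimage[OF C(2)] by metis
  qed
  then have "Inf ?S \<in> ?S" using closed_contains_Inf[OF _ bdd] ne by blast
  then have M: "cone_M C x y \<in> ?S" by (simp add: cone_M_def cone_le_def)
  then show "0 < cone_M C x y" "cone_M C x y *\<^sub>R y - x \<in> C" using pos by auto
  show "cone_M C x y \<le> b" if "b *\<^sub>R y - x \<in> C" for b
    using cInf_lower[OF _ bdd, of b] that by (simp add: cone_M_def cone_le_def)
qed

lemma Metric_space_thompson:
  assumes C: "ordering_cone C" "closed C" "0 \<notin> interior C"
  shows "Metric_space (interior C) (thompson C)"
proof -
  note D = ordering_coneD[OF C(1)]
  note M = cone_M_interior[OF C]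
  let ?I = "interior C"
  have sub: "cone_M C x z \<le> cone_M C x y * cone_M C y z" if "x \<in> ?I" "y \<in> ?I" "z \<in> ?I" for x y z
  proof -
    have "cone_M C x y *\<^sub>R (cone_M C y z *\<^sub>R z - y) + (cone_M C x y *\<^sub>R y - x) \<in> C"
      using D(2,3) M(1,2) that less_imp_le by metis
    then have "(cone_M C x y * cone_M C y z) *\<^sub>R z - x \<in> C"
      by (simp add: scaleR_diff_right)
    then show ?thesis using M(3) that by blast
  qed
  have self: "1 \<le> cone_M C x x" if "x \<in> ?I" for x
  proof (rule ccontr)
    assume "\<not> ?thesis"
    then have "0 \<le> 1 / (1 - cone_M C x x)" and lt: "cone_M C x x < 1" by auto
    then have "(1 / (1 - cone_M C x x)) *\<^sub>R (cone_M C x x *\<^sub>R x - x) \<in> C"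
      using D(2) M(2)[OF that that] by blast
    moreover have "cone_M C x x *\<^sub>R x - x = (- (1 - cone_M C x x)) *\<^sub>R x"
      by (simp add: scaleR_diff_left)
    moreover have "(1 / (1 - cone_M C x x)) *\<^sub>R ((- (1 - cone_M C x x)) *\<^sub>R x) = - x"
      using lt by (simp del: minus_diff_eq)
    ultimately have "- x \<in> C" by simp
    then show False using D(4) that C(3) interior_subset by (metis subsetD)
  qed
  have selfle: "cone_M C x x \<le> 1" if "x \<in> ?I" for x
    using M(3)[OF that that, of 1] D(1) by simp
  define m where "m x y = max (cone_M C x y) (cone_M C y x)" for x y
  have m1: "1 \<le> m x y" if "x \<in> ?I" "y \<in> ?I" for x y
  proof (rule ccontr)
    assume "\<not> ?thesis"
    then have "cone_M C x y * cone_M C y x < 1 * 1"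
      using M(1) that by (intro mult_strict_mono) (auto simp: m_def less_imp_le)
    then show False using sub[OF that that(1)] self[OF that(1)] by simp
  qed
  have mm: "m x z \<le> m x y * m y z" if "x \<in> ?I" "y \<in> ?I" "z \<in> ?I" for x y z
  proof -
    have "cone_M C x y * cone_M C y z \<le> m x y * m y z"
      using M(1) that m1 by (intro mult_mono) (auto simp: m_def less_imp_le max_def)
    moreover have "cone_M C z y * cone_M C y x \<le> m y z * m x y"
      using M(1) that m1 by (intro mult_mono) (auto simp: m_def less_imp_le max_def)
    ultimately show ?thesis
      using sub[of x y z] sub[of z y x] that by (simp add: m_def mult.commute)
  qed
  have th: "thompson C x y = (if x \<in> ?I \<and> y \<in> ?I then ln (m x y) else 0)" for x y
    by (simp add: thompson_def m_def)
  show ?thesis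
  proof
    show "0 \<le> thompson C x y" for x y using m1 by (simp add: th)
    show "thompson C x y = thompson C y x" for x y by (simp add: th m_def max.commute)
    show "thompson C x y = 0 \<longleftrightarrow> x = y" if "x \<in> ?I" "y \<in> ?I" for x y
    proof
      assume "thompson C x y = 0"
      then have "m x y = 1" using m1[OF that] that by (simp add: th)
      then have le: "cone_M C x y \<le> 1" "cone_M C y x \<le> 1" by (auto simp: m_def)
      have *: "v - u \<in> C" if "u \<in> ?I" "v \<in> ?I" "cone_M C u v \<le> 1" for u v
      proof -
        have "(1 - cone_M C u v) *\<^sub>R v + (cone_M C u v *\<^sub>R v - u) \<in> C"
          using D(2,3) M(2) that interior_subset by (metis diff_ge_0_iff_ge subsetD)
        then show ?thesis by (simp add: scaleR_diff_left)
      qed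
      have "y - x \<in> C" "- (y - x) \<in> C" using * that le by auto
      then show "x = y" using D(4) by fastforce
    next
      assume "x = y"
      moreover have "cone_M C x x = 1" using self selfle that(1) by (simp add: antisym)
      ultimately show "thompson C x y = 0" by (simp add: th m_def)
    qed
    show "thompson C x z \<le> thompson C x y + thompson C y z"
      if "x \<in> ?I" "y \<in> ?I" "z \<in> ?I" for x y z
    proof -
      have p: "0 < m u v" if "u \<in> ?I" "v \<in> ?I" for u v using m1[OF that] by simp
      have "ln (m x z) \<le> ln (m x y * m y z)"
        using mm[OF that] p that by simp
      also have "\<dots> = ln (m x y) + ln (m y z)"
        by (intro ln_mult_pos p that)
      finally show ?thesis using that by (simp add: th)
    qed
  qed
qed

end

theory Submission
  imports Defs
begin

text \<open>
  Write \<open>\<preceq>\<close> for the order of \<open>C\<close>, \<open>u = x\<^sub>0\<close>, \<open>x n\<close> for the \<open>n\<close>-th iterate of \<open>u\<close>, and \<open>a n\<close> for the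
  Thompson distance of \<open>u\<close> and \<open>x n\<close>. The sequence \<open>a\<close> is unbounded: otherwise the points \<open>z\<close> for
  which the limit superior of the distance to \<open>x n\<close> is at most a bound of \<open>a\<close> would form a nonempty
  bounded closed convex invariant set, and the fixed point property would give a fixed point
  (\<open>fixed_point_of_bounded_orbit\<close>). So there are record times \<open>N i\<close>, at which \<open>a\<close> is at least all its
  earlier values, with \<open>a (N i)\<close> tending to infinity and, by compactness, with \<open>x (N i)\<close> norm
  convergent to some \<open>\<zeta>\<close>. Let \<open>\<Omega>\<close> be the set of all \<open>z \<in> C\<close> such
  that, for every \<open>\<epsilon> > 0\<close>, \<open>z \<preceq> \<epsilon> exp (a (N i)) x (N i)\<close> for all large \<open>i\<close>.

  It is convex. It contains no interior point, because \<open>u\<close> is dominated by a multiple of each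
  interior point, while \<open>exp (a (N i))\<close> is the least factor \<open>b\<close> with \<open>u \<preceq> b x (N i)\<close> for large \<open>i\<close>:
  the other inequality in Thompson's metric, \<open>x (N i) \<preceq> b u\<close>, holds with a fixed \<open>b\<close>, as the orbit
  is norm bounded.

  The main point is that \<open>\<Omega>\<close> absorbs the orbit, in the sense that for every \<open>\<epsilon> > 0\<close> and all large
  \<open>n\<close>, \<open>x n \<preceq> \<epsilon> exp (a (N i)) x (N i)\<close> for large \<open>i\<close> (\<open>orbit_negligible\<close>). Choose \<open>k\<close> with \<open>x k\<close> so
  close to \<open>\<zeta>\<close> that \<open>x k \<preceq> x (N i) + 2 \<delta> u\<close> for large \<open>i\<close>, and let \<open>n = k + m\<close>. The point
  \<open>x (N i - m)\<close> dominates \<open>x (N i)\<close> up to the factor \<open>exp (a m)\<close>, which does not depend on \<open>i\<close>, and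
  it dominates \<open>u\<close> up to the factor \<open>exp (a (N i))\<close>, because \<open>N i\<close> is a record time. Therefore
  \<open>x k \<preceq> 3 \<delta> exp (a (N i)) x (N i - m)\<close> for large \<open>i\<close>. Since the reverse comparison costs only a
  bounded factor, this bounds the Thompson distance of \<open>x k\<close> and \<open>x (N i - m)\<close>, and applying \<open>f\<close>
  another \<open>m\<close> times transfers the bound to \<open>x n\<close> and \<open>x (N i)\<close>. Other orbits stay at bounded
  Thompson distance from this one, so their limit points belong to \<open>\<Omega>\<close> as well.
\<close>

section \<open>The order of a closed cone and Thompson's metric\<close>

text \<open>Excluding \<open>0\<close> from the interior excludes only the zero space.\<close>

locale closed_ordering_cone =
  fixes C :: "'a::real_normed_vector set"
  assumes ordering_cone: "ordering_cone C"
    and closed: "closed C"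
    and zero_notin_interior: "0 \<notin> interior C"
begin

abbreviation le (infix "\<preceq>" 50) where "x \<preceq> y \<equiv> cone_le C x y"

lemma le_trans [trans]: "x \<preceq> y \<Longrightarrow> y \<preceq> z \<Longrightarrow> x \<preceq> z"
  unfolding cone_le_def using ordering_coneD(3)[OF ordering_cone, of "y - x" "z - y"] by simp

lemma le_add_mono: "x \<preceq> y \<Longrightarrow> x' \<preceq> y' \<Longrightarrow> x + x' \<preceq> y + y'"
  unfolding cone_le_def using ordering_coneD(3)[OF ordering_cone, of "y - x" "y' - x'"]
  by (simp add: algebra_simps)

lemma le_scaleR_mono: "x \<preceq> y \<Longrightarrow> c \<ge> 0 \<Longrightarrow> c *\<^sub>R x \<preceq> c *\<^sub>R y"
  unfolding cone_le_def using ordering_coneD(2)[OF ordering_cone, of "y - x" c]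
  by (simp add: scaleR_diff_right)

lemma le_scaleR_left_mono: "x \<in> C \<Longrightarrow> c \<le> d \<Longrightarrow> c *\<^sub>R x \<preceq> d *\<^sub>R x"
  unfolding cone_le_def using ordering_coneD(2)[OF ordering_cone, of x "d - c"]
  by (simp add: scaleR_diff_left)

lemma interior_imp_mem: "x \<in> interior C \<Longrightarrow> x \<in> C"
  using interior_subset by blast

text \<open>Each interior point is an order unit, with a factor linear in the norm.\<close>

lemma interior_order_unit:
  assumes "u \<in> interior C"
  obtains e where "e > 0" "\<And>v c. norm v \<le> e * c \<Longrightarrow> c > 0 \<Longrightarrow> v \<preceq> c *\<^sub>R u"
proof -
  obtain e where e: "e > 0" "cball u e \<subseteq> C" using assms mem_interior_cball by metis
  have "v \<preceq> c *\<^sub>R u" if v: "norm v \<le> e * c" and c: "c > 0" for v c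
  proof -
    have "dist u (u - (1/c) *\<^sub>R v) \<le> e"
      using v c by (simp add: dist_norm field_simps)
    then have "c *\<^sub>R (u - (1/c) *\<^sub>R v) \<in> C"
      using e ordering_coneD(2)[OF ordering_cone, of _ c] c by (simp add: subset_iff)
    then show ?thesis using c by (simp add: cone_le_def scaleR_diff_right)
  qed
  with e(1) that show thesis by blast
qed

lemma thompson_le_ln_iff:
  assumes "x \<in> interior C" "y \<in> interior C" "b > 0"
  shows "thompson C x y \<le> ln b \<longleftrightarrow> x \<preceq> b *\<^sub>R y \<and> y \<preceq> b *\<^sub>R x"
proof -
  have M: "cone_M C v w \<le> b \<longleftrightarrow> v \<preceq> b *\<^sub>R w"
    if "v \<in> interior C" "w \<in> interior C" for v w
  proof
    assume "cone_M C v w \<le> b"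
    then have "cone_M C v w *\<^sub>R w \<preceq> b *\<^sub>R w"
      using le_scaleR_left_mono that(2) interior_imp_mem by blast
    moreover have "v \<preceq> cone_M C v w *\<^sub>R w"
      using cone_M_interior(2)[OF ordering_cone closed zero_notin_interior that]
      by (simp add: cone_le_def)
    ultimately show "v \<preceq> b *\<^sub>R w" using le_trans by blast
  qed (use cone_M_interior(3)[OF ordering_cone closed zero_notin_interior that] in
      \<open>simp add: cone_le_def\<close>)
  have "0 < max (cone_M C x y) (cone_M C y x)"
    using cone_M_interior(1)[OF ordering_cone closed zero_notin_interior] assms
    by (simp add: less_max_iff_disj)
  then show ?thesis
    using assms M by (simp add: thompson_def)
qed

lemma thompson_le_iff:
  assumes "x \<in> interior C" "y \<in> interior C"
  shows "thompson C x y \<le> r \<longleftrightarrow> x \<preceq> exp r *\<^sub>R y \<and> y \<preceq> exp r *\<^sub>R x"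
  using thompson_le_ln_iff[OF assms, of "exp r"] by simp

lemma thompson_convex_combination_le:
  assumes "x \<in> interior C" "y \<in> interior C" "z \<in> interior C"
    and "thompson C x z \<le> r" "thompson C y z \<le> r"
    and "s \<ge> 0" "t \<ge> 0" "s + t = 1"
  shows "thompson C (s *\<^sub>R x + t *\<^sub>R y) z \<le> r"
proof -
  have I: "s *\<^sub>R x + t *\<^sub>R y \<in> interior C"
    using assms ordering_cone convex_interior[of C]
    by (auto simp: ordering_cone_def convex_def)
  have "s *\<^sub>R x + t *\<^sub>R y \<preceq> s *\<^sub>R (exp r *\<^sub>R z) + t *\<^sub>R (exp r *\<^sub>R z)"
    using assms thompson_le_iff by (intro le_add_mono le_scaleR_mono) auto
  moreover have "s *\<^sub>R z + t *\<^sub>R z \<preceq> s *\<^sub>R (exp r *\<^sub>R x) + t *\<^sub>R (exp r *\<^sub>R y)"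
    using assms thompson_le_iff by (intro le_add_mono le_scaleR_mono) auto
  moreover have "s *\<^sub>R w + t *\<^sub>R w = w" for w :: 'a
    using assms(8) by (metis scaleR_add_left scaleR_one)
  moreover have "s *\<^sub>R (exp r *\<^sub>R x) + t *\<^sub>R (exp r *\<^sub>R y) = exp r *\<^sub>R (s *\<^sub>R x + t *\<^sub>R y)"
    by (simp add: scaleR_add_right mult.commute)
  ultimately show ?thesis
    unfolding thompson_le_iff[OF I assms(3)] by metis
qed

end

sublocale closed_ordering_cone \<subseteq> Metric_space "interior C" "thompson C"
  using Metric_space_thompson ordering_cone closed zero_notin_interior .

section \<open>Orbits of fixed point free nonexpansive maps\<close>

locale thompson_nonexpansive_map = closed_ordering_cone C
  for C :: "'a::real_normed_vector set" +
  fixes f :: "'a \<Rightarrow> 'a"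
  assumes maps_interior: "f \<in> interior C \<rightarrow> interior C"
    and nonexpansive: "thompson_nonexpansive C f"
begin

lemma funpow_interior: "x \<in> interior C \<Longrightarrow> (f ^^ n) x \<in> interior C"
  using maps_interior by (induction n) auto

lemma funpow_nonexpansive:
  assumes "x \<in> interior C" "y \<in> interior C"
  shows "thompson C ((f ^^ n) x) ((f ^^ n) y) \<le> thompson C x y"
proof (induction n)
  case (Suc n)
  have "thompson C (f ((f ^^ n) x)) (f ((f ^^ n) y)) \<le> thompson C ((f ^^ n) x) ((f ^^ n) y)"
    using nonexpansive funpow_interior assms by (simp add: thompson_nonexpansive_def)
  with Suc show ?case by simp
qed simp

text \<open>If the orbit of \<open>x\<close> stays within distance \<open>r\<close> of \<open>x\<close>, then the points \<open>z\<close> whose distances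
  to the orbit have limit superior at most \<open>r\<close> form a nonempty, bounded, closed and invariant set,
  which is convex because Thompson balls are order intervals.\<close>

lemma fixed_point_of_bounded_orbit:
  assumes fpp: "thompson_fpp C f" and x: "x \<in> interior C"
    and r: "\<And>n. thompson C x ((f ^^ n) x) \<le> r"
  shows "\<exists>y\<in>interior C. f y = y"
proof -
  define D where "D = {z \<in> interior C.
    \<forall>s>r. \<forall>\<^sub>F k in sequentially. thompson C z ((f ^^ k) x) \<le> s}"
  have DI: "D \<subseteq> interior C" by (auto simp: D_def)
  have "thompson C x ((f ^^ n) x) \<le> s" if "s > r" for s n
    using r[of n] that by linarith
  then have "x \<in> D" using x by (simp add: D_def)
  then have "D \<noteq> {}" by blast
  moreover have "mbounded D"
  proof -
    have "D \<subseteq> mcball x (r + (r + 1))"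
    proof
      fix z assume z: "z \<in> D"
      have "\<forall>\<^sub>F k in sequentially. thompson C z ((f ^^ k) x) \<le> r + 1"
        using z by (simp add: D_def)
      then obtain k where "thompson C z ((f ^^ k) x) \<le> r + 1"
        by (auto simp: eventually_sequentially)
      moreover have "thompson C x z \<le> thompson C x ((f ^^ k) x) + thompson C ((f ^^ k) x) z"
        using triangle x z DI funpow_interior by blast
      ultimately show "z \<in> mcball x (r + (r + 1))"
        using r[of k] x z DI commute[of z] by auto
    qed
    then show ?thesis unfolding mbounded_def by blast
  qed
  moreover have "convex D"
    unfolding convex_def
  proof (intro ballI allI impI)
    fix y z and s t :: real
    assume yz: "y \<in> D" "z \<in> D" and st: "0 \<le> s" "0 \<le> t" "s + t = 1"
    have "s *\<^sub>R y + t *\<^sub>R z \<in> interior C"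
      using convexD[OF convex_interior[of C]] yz DI st ordering_cone
      unfolding ordering_cone_def by blast
    moreover have "\<forall>\<^sub>F k in sequentially. thompson C (s *\<^sub>R y + t *\<^sub>R z) ((f ^^ k) x) \<le> q"
      if q: "q > r" for q
    proof -
      have "\<forall>\<^sub>F k in sequentially. thompson C y ((f ^^ k) x) \<le> q"
        and "\<forall>\<^sub>F k in sequentially. thompson C z ((f ^^ k) x) \<le> q"
        using yz q by (auto simp: D_def)
      then show ?thesis
        by eventually_elim
          (use yz DI st x funpow_interior thompson_convex_combination_le in blast)
    qed
    ultimately show "s *\<^sub>R y + t *\<^sub>R z \<in> D" by (simp add: D_def)
  qed
  moreover have "closedin mtopology D"
    unfolding closedin_metric
  proof (intro conjI allI impI DI)
    fix z assume "z \<in> interior C - D"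
    then obtain s where z: "z \<in> interior C" and s: "s > r"
      and nev: "\<not> (\<forall>\<^sub>F k in sequentially. thompson C z ((f ^^ k) x) \<le> s)"
      by (auto simp: D_def)
    have "w \<notin> mball z ((s - r) / 2)" if w: "w \<in> D" for w
    proof
      assume "w \<in> mball z ((s - r) / 2)"
      then have zw: "thompson C z w < (s - r) / 2" by simp
      have "(s + r) / 2 > r" using s by simp
      then have "\<forall>\<^sub>F k in sequentially. thompson C w ((f ^^ k) x) \<le> (s + r) / 2"
        using w unfolding D_def by blast
      then have "\<forall>\<^sub>F k in sequentially. thompson C z ((f ^^ k) x) \<le> s"
      proof eventually_elim
        case (elim k)
        have "thompson C z ((f ^^ k) x) \<le> thompson C z w + thompson C w ((f ^^ k) x)"
          using triangle z w DI x funpow_interior by blast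
        with elim zw show ?case by (simp add: field_simps)
      qed
      with nev show False by blast
    qed
    then have "disjnt D (mball z ((s - r) / 2))" by (auto simp: disjnt_def)
    then show "\<exists>r>0. disjnt D (mball z r)" using s by (intro exI[of _ "(s - r) / 2"]) simp
  qed
  moreover have "f ` D \<subseteq> D"
  proof
    fix w assume "w \<in> f ` D"
    then obtain z where z: "z \<in> D" and w: "w = f z" by blast
    have "\<forall>\<^sub>F k in sequentially. thompson C w ((f ^^ k) x) \<le> s" if "s > r" for s
    proof -
      have "\<forall>\<^sub>F k in sequentially. thompson C z ((f ^^ k) x) \<le> s"
        using z that by (simp add: D_def)
      then have "\<forall>\<^sub>F k in sequentially. thompson C w ((f ^^ Suc k) x) \<le> s"
      proof eventually_elim
        case (elim k)
        have "thompson C (f z) (f ((f ^^ k) x)) \<le> thompson C z ((f ^^ k) x)"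
          using nonexpansive z DI x funpow_interior by (auto simp: thompson_nonexpansive_def)
        with elim w show ?case by simp
      qed
      then show ?thesis by (subst (asm) eventually_sequentially_Suc)
    qed
    moreover have "w \<in> interior C" using w z DI maps_interior by auto
    ultimately show "w \<in> D" by (simp add: D_def)
  qed
  ultimately have "\<exists>y\<in>D. f y = y" using fpp unfolding thompson_fpp_def by blast
  then show ?thesis using DI by blast
qed

end

lemma unbounded_sequence_records:
  fixes a :: "nat \<Rightarrow> real"
  assumes unbounded: "\<And>r. \<exists>n. r < a n"
  obtains N :: "nat \<Rightarrow> nat"
    where "strict_mono N" "\<And>i m. m \<le> N i \<Longrightarrow> a m \<le> a (N i)"
      "filterlim (\<lambda>i. a (N i)) at_top sequentially"
proof -
  define S where "S = {n. \<forall>m<n. a m < a n}"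
  have ex: "\<exists>n\<in>S. r < a n" for r
  proof -
    define n where "n = (LEAST n. r < a n)"
    have "r < a n" using unbounded[of r] unfolding n_def by (rule LeastI_ex)
    moreover have "a m \<le> r" if "m < n" for m
      using not_less_Least that unfolding n_def by fastforce
    ultimately have "n \<in> S" by (fastforce simp: S_def)
    with \<open>r < a n\<close> show ?thesis by blast
  qed
  have "infinite S"
  proof
    assume fin: "finite S"
    obtain n where "n \<in> S" "Max (a ` S) < a n" using ex by blast
    then show False using fin by (meson Max_ge finite_imageI imageI leD)
  qed
  then obtain N :: "nat \<Rightarrow> nat" where N: "strict_mono N" "\<And>i. N i \<in> S"
    using infinite_enumerate[of S] by metis
  have "filterlim (\<lambda>i. a (N i)) at_top sequentially"
    unfolding filterlim_at_top
  proof
    fix r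
    obtain n where n: "n \<in> S" "r < a n" using ex by blast
    have "r \<le> a (N i)" if "i > n" for i
    proof -
      have "n < N i" using that seq_suble[OF N(1), of i] by linarith
      then have "a n < a (N i)" using N(2)[of i] by (simp add: S_def)
      with n show ?thesis by simp
    qed
    then show "\<forall>\<^sub>F i in sequentially. r \<le> a (N i)"
      by (rule eventually_mono[OF eventually_gt_at_top[of n]])
  qed
  moreover have "a m \<le> a (N i)" if "m \<le> N i" for i m
    using N(2)[of i] that by (cases "m = N i") (auto simp: S_def less_imp_le)
  ultimately show thesis using that N(1) by blast
qed

section \<open>Smallness of the orbit relative to its record points\<close>

context thompson_nonexpansive_map
begin

text \<open>Along record times \<open>N i\<close> of the distance from \<open>u\<close>, the factor \<open>exp (thompson C u ((f ^^ N i) u))\<close>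
  is, for large \<open>i\<close>, the least one by which \<open>(f ^^ N i) u\<close> dominates \<open>u\<close>; to dominate late points of the orbit, any small
  fraction of it suffices.\<close>

lemma orbit_negligible:
  assumes u: "u \<in> interior C"
    and records: "\<And>i m. m \<le> N i \<Longrightarrow> thompson C u ((f ^^ m) u) \<le> thompson C u ((f ^^ N i) u)"
    and unbounded: "filterlim (\<lambda>i. thompson C u ((f ^^ N i) u)) at_top sequentially"
    and mono: "strict_mono N"
    and lim: "(\<lambda>i. (f ^^ N i) u) \<longlonglongrightarrow> \<zeta>"
    and K: "\<And>n. (f ^^ n) u \<preceq> K *\<^sub>R u" "K \<ge> 0"
    and \<epsilon>: "\<epsilon> > 0"
  shows "\<exists>k. \<forall>n\<ge>k. \<forall>\<^sub>F i in sequentially.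
    (f ^^ n) u \<preceq> (\<epsilon> * exp (thompson C u ((f ^^ N i) u))) *\<^sub>R (f ^^ N i) u"
proof -
  define x where "x n = (f ^^ n) u" for n
  define a where "a n = thompson C u (x n)" for n
  define \<delta> where "\<delta> = \<epsilon> / 3"
  have \<delta>: "\<delta> > 0" using \<epsilon> by (simp add: \<delta>_def)
  have xI: "x n \<in> interior C" for n using funpow_interior u by (simp add: x_def)
  have xa: "u \<preceq> exp (a n) *\<^sub>R x n" "x n \<preceq> exp (a n) *\<^sub>R u" for n
    using thompson_le_iff[OF u xI, of n "a n"] by (auto simp: a_def)
  obtain e where e: "e > 0" "\<And>v c. norm v \<le> e * c \<Longrightarrow> c > 0 \<Longrightarrow> v \<preceq> c *\<^sub>R u"
    using interior_order_unit[OF u] by blast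
  have near: "\<forall>\<^sub>F i in sequentially. norm (x (N i) - \<zeta>) < e * \<delta>"
    using tendstoD[OF lim, of "e * \<delta>"] e(1) \<delta> by (simp add: x_def dist_norm)
  then obtain p where p: "norm (x (N p) - \<zeta>) < e * \<delta>"
    by (auto simp: eventually_sequentially)
  define k where "k = N p"
  have "\<forall>\<^sub>F i in sequentially. x n \<preceq> (\<epsilon> * exp (a (N i))) *\<^sub>R x (N i)" if n: "n \<ge> k" for n
  proof -
    define m where "m = n - k"
    have n_eq: "n = m + k" using n by (simp add: m_def)
    have "filterlim (\<lambda>i. exp (a (N i))) at_top sequentially"
      using filterlim_compose[OF exp_at_top unbounded] by (simp add: a_def x_def)
    then have large: "\<forall>\<^sub>F i in sequentially. c \<le> exp (a (N i))" for c
      by (simp add: filterlim_at_top)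
    show ?thesis
      using near large[of "exp (a m) / \<delta>"] large[of "K * exp (a k) / \<epsilon>"] eventually_ge_at_top[of m]
    proof eventually_elim
      case (elim i)
      define b where "b = exp (a (N i))"
      define l where "l = N i - m"
      have b: "exp (a m) \<le> \<delta> * b" "K * exp (a k) \<le> \<epsilon> * b" "b > 0"
        using elim \<delta> \<epsilon> by (auto simp: b_def field_simps)
      have N_eq: "N i = m + l"
        using elim(4) seq_suble[OF mono, of i] by (simp add: l_def)
      have "norm (x k - x (N i)) \<le> norm (x k - \<zeta>) + norm (x (N i) - \<zeta>)"
        by (metis dist_norm dist_triangle2)
      also have "\<dots> \<le> e * (2 * \<delta>)" using p elim(1) by (simp add: k_def)
      finally have "x k - x (N i) \<preceq> (2 * \<delta>) *\<^sub>R u" using e(2) \<delta> by simp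
      then have 1: "x k \<preceq> x (N i) + (2 * \<delta>) *\<^sub>R u" by (simp add: cone_le_def algebra_simps)
      \<comment> \<open>The point \<open>x l\<close> precedes a record time by a fixed number \<open>m\<close> of steps. Hence it dominates
        \<open>x (N i)\<close> up to the fixed factor \<open>exp (a m)\<close>, and \<open>u\<close> up to the record factor \<open>b\<close>.\<close>
      have "x (N i) \<preceq> exp (a m) *\<^sub>R x l"
      proof -
        have "thompson C (x l) (x (N i)) \<le> a m"
          using funpow_nonexpansive[OF u xI, of l m]
          by (simp add: x_def a_def N_eq add.commute[of m] funpow_add)
        then show ?thesis using thompson_le_iff xI by blast
      qed
      moreover have "u \<preceq> b *\<^sub>R x l"
      proof -
        have "a l \<le> a (N i)" using records[of l i] by (simp add: a_def x_def l_def)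
        then show ?thesis
          using le_trans[OF xa(1) le_scaleR_left_mono[OF interior_imp_mem[OF xI]]]
          by (simp add: b_def)
      qed
      then have "(2 * \<delta>) *\<^sub>R u \<preceq> (2 * \<delta>) *\<^sub>R (b *\<^sub>R x l)"
        using \<delta> by (intro le_scaleR_mono) auto
      ultimately have "x (N i) + (2 * \<delta>) *\<^sub>R u \<preceq> exp (a m) *\<^sub>R x l + (2 * \<delta>) *\<^sub>R (b *\<^sub>R x l)"
        by (rule le_add_mono)
      with 1 have "x k \<preceq> (exp (a m) + 2 * \<delta> * b) *\<^sub>R x l"
        using le_trans by (simp add: scaleR_add_left)
      moreover have "\<dots> \<preceq> (\<epsilon> * b) *\<^sub>R x l"
        using b(1) by (intro le_scaleR_left_mono interior_imp_mem xI) (simp add: \<delta>_def)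
      ultimately have 2: "x k \<preceq> (\<epsilon> * b) *\<^sub>R x l" by (rule le_trans)
      have "x l \<preceq> K *\<^sub>R u" using K by (simp add: x_def)
      also have "K *\<^sub>R u \<preceq> K *\<^sub>R (exp (a k) *\<^sub>R x k)" using xa K(2) by (intro le_scaleR_mono)
      also have "\<dots> \<preceq> (\<epsilon> * b) *\<^sub>R x k"
        using le_scaleR_left_mono[OF interior_imp_mem[OF xI] b(2)] by simp
      finally have 3: "x l \<preceq> (\<epsilon> * b) *\<^sub>R x k" .
      have "thompson C (x k) (x l) \<le> ln (\<epsilon> * b)"
        using 2 3 \<epsilon> b(3) by (subst thompson_le_ln_iff[OF xI xI]) auto
      then have "thompson C (x n) (x (N i)) \<le> ln (\<epsilon> * b)"
        using funpow_nonexpansive[OF xI xI, of m k l] by (simp add: x_def n_eq N_eq funpow_add)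
      then show ?case
        using \<epsilon> b(3) by (subst (asm) thompson_le_ln_iff[OF xI xI]) (auto simp: b_def)
    qed
  qed
  then show ?thesis unfolding x_def a_def by blast
qed

lemma omega_limit_sets_in_convex_boundary_set:
  assumes fpp: "thompson_fpp C f" and no_fixed: "\<forall>x\<in>interior C. f x \<noteq> x"
    and u: "u \<in> interior C" and compact: "compact (closure (orbit_set f u))"
  shows "\<exists>\<Omega>. convex \<Omega> \<and> \<Omega> \<subseteq> frontier C \<and> (\<forall>x\<in>interior C. omega_limit_set f x \<subseteq> \<Omega>)"
proof -
  define a where "a n = thompson C u ((f ^^ n) u)" for n
  have "\<exists>n. r < a n" for r
    using fixed_point_of_bounded_orbit[OF fpp u, of r] no_fixed
    by (auto simp: a_def not_le[symmetric])
  then obtain N' where N': "strict_mono N'" "\<And>i m. m \<le> N' i \<Longrightarrow> a m \<le> a (N' i)"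
      "filterlim (\<lambda>i. a (N' i)) at_top sequentially"
    using unbounded_sequence_records by blast
  have orb: "(f ^^ n) u \<in> closure (orbit_set f u)" for n
    using closure_subset[of "orbit_set f u"] by (auto simp: orbit_set_def)
  obtain \<zeta> \<rho> where \<rho>: "strict_mono \<rho>" "((\<lambda>i. (f ^^ N' i) u) \<circ> \<rho>) \<longlonglongrightarrow> \<zeta>"
    using compact orb unfolding compact_def by (metis (no_types, lifting))
  define N where "N = N' \<circ> \<rho>"
  define y where "y i = exp (a (N i)) *\<^sub>R (f ^^ N i) u" for i
  have mono: "strict_mono N" using N'(1) \<rho>(1) by (simp add: N_def strict_mono_o)
  have lim: "(\<lambda>i. (f ^^ N i) u) \<longlonglongrightarrow> \<zeta>" using \<rho>(2) by (simp add: N_def o_def)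
  have records: "m \<le> N i \<Longrightarrow> a m \<le> a (N i)" for i m using N'(2) by (simp add: N_def)
  have unbounded: "filterlim (\<lambda>i. a (N i)) at_top sequentially"
    using filterlim_compose[OF N'(3) filterlim_subseq[OF \<rho>(1)]] by (simp add: N_def)
  have uy: "u \<preceq> y i" for i
    using thompson_le_iff[OF u funpow_interior[OF u], of "N i" "a (N i)"] by (simp add: y_def a_def)
  obtain e where e: "e > 0" "\<And>v c. norm v \<le> e * c \<Longrightarrow> c > 0 \<Longrightarrow> v \<preceq> c *\<^sub>R u"
    using interior_order_unit[OF u] by blast
  obtain B where B: "B > 0" "\<And>n. norm ((f ^^ n) u) \<le> B"
    using compact_imp_bounded[OF compact] orb unfolding bounded_pos by blast
  have K: "(f ^^ n) u \<preceq> (B / e) *\<^sub>R u" for n using e B by (intro e(2)) auto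
  have K_nonneg: "B / e \<ge> 0" using B(1) e(1) by simp
  define \<Omega> where "\<Omega> = {z \<in> C. \<forall>\<epsilon>>0. \<forall>\<^sub>F i in sequentially. z \<preceq> \<epsilon> *\<^sub>R y i}"
  have "convex \<Omega>"
    unfolding convex_def
  proof (intro ballI allI impI)
    fix v w and s t :: real
    assume vw: "v \<in> \<Omega>" "w \<in> \<Omega>" and st: "0 \<le> s" "0 \<le> t" "s + t = 1"
    have "s *\<^sub>R v + t *\<^sub>R w \<in> C"
      using vw st ordering_cone by (auto simp: \<Omega>_def ordering_cone_def convex_def)
    moreover have "\<forall>\<^sub>F i in sequentially. s *\<^sub>R v + t *\<^sub>R w \<preceq> \<epsilon> *\<^sub>R y i" if "\<epsilon> > 0" for \<epsilon>
    proof -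
      have "\<forall>\<^sub>F i in sequentially. v \<preceq> \<epsilon> *\<^sub>R y i" "\<forall>\<^sub>F i in sequentially. w \<preceq> \<epsilon> *\<^sub>R y i"
        using vw that by (auto simp: \<Omega>_def)
      then show ?thesis
      proof eventually_elim
        case (elim i)
        have "s *\<^sub>R v + t *\<^sub>R w \<preceq> s *\<^sub>R (\<epsilon> *\<^sub>R y i) + t *\<^sub>R (\<epsilon> *\<^sub>R y i)"
          using elim st by (intro le_add_mono le_scaleR_mono)
        then show ?case using st(3) by (metis scaleR_add_left scaleR_one)
      qed
    qed
    ultimately show "s *\<^sub>R v + t *\<^sub>R w \<in> \<Omega>" by (simp add: \<Omega>_def)
  qed
  moreover have "\<Omega> \<subseteq> frontier C"
  proof
    fix z assume z: "z \<in> \<Omega>"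
    have "z \<notin> interior C"
    proof
      assume zI: "z \<in> interior C"
      \<comment> \<open>Smallness of \<open>z\<close> halves the factor by which \<open>(f ^^ N i) u\<close> dominates \<open>u\<close>, so the distance
        of \<open>u\<close> and \<open>(f ^^ N i) u\<close> for large \<open>i\<close> would be at most \<open>a (N i) - ln 2\<close>.\<close>
      define c where "c = cone_M C u z"
      have c: "c > 0" "u \<preceq> c *\<^sub>R z"
        using cone_M_interior(1,2)[OF ordering_cone closed zero_notin_interior u zI]
        by (auto simp: c_def cone_le_def)
      have "\<forall>\<^sub>F i in sequentially. z \<preceq> (1 / (2 * c)) *\<^sub>R y i"
        using z c by (auto simp: \<Omega>_def)
      moreover have "\<forall>\<^sub>F i in sequentially. 2 * (B / e) \<le> exp (a (N i))"
        using filterlim_compose[OF exp_at_top unbounded] by (simp add: filterlim_at_top)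
      ultimately have "\<forall>\<^sub>F i in sequentially. False"
      proof eventually_elim
        case (elim i)
        define b where "b = exp (a (N i)) / 2"
        have "c *\<^sub>R z \<preceq> c *\<^sub>R ((1 / (2 * c)) *\<^sub>R y i)"
          using elim c by (intro le_scaleR_mono) auto
        then have "u \<preceq> b *\<^sub>R (f ^^ N i) u"
          using le_trans[OF c(2)] c(1) by (simp add: y_def b_def)
        moreover have "B / e \<le> b" using elim(2) by (simp add: b_def mult.commute)
        then have "(f ^^ N i) u \<preceq> b *\<^sub>R u"
          by (rule le_trans[OF K le_scaleR_left_mono[OF interior_imp_mem[OF u]]])
        ultimately have "a (N i) \<le> ln b"
          unfolding a_def
          by (subst thompson_le_ln_iff[OF u funpow_interior[OF u]]) (auto simp: b_def)
        then show False by (simp add: b_def ln_div)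
      qed
      then show False by simp
    qed
    then show "z \<in> frontier C"
      using z closed by (simp add: frontier_def \<Omega>_def)
  qed
  moreover have "omega_limit_set f x \<subseteq> \<Omega>" if x: "x \<in> interior C" for x
  proof
    fix z assume "z \<in> omega_limit_set f x"
    then obtain q where q: "strict_mono q" "(\<lambda>i. (f ^^ q i) x) \<longlonglongrightarrow> z"
      by (auto simp: omega_limit_set_def)
    have "z \<in> C"
      using closed_sequentially[OF closed _ q(2)] funpow_interior[OF x] interior_imp_mem by blast
    moreover have "\<forall>\<^sub>F i in sequentially. z \<preceq> \<epsilon> *\<^sub>R y i" if \<epsilon>: "\<epsilon> > 0" for \<epsilon>
    proof -
      define R where "R = exp (thompson C x u)"
      have R: "R > 0" by (simp add: R_def)
      define \<delta> where "\<delta> = \<epsilon> / (2 * R)"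
      have \<delta>: "\<delta> > 0" using \<epsilon> R by (simp add: \<delta>_def)
      obtain k where k: "\<And>n. n \<ge> k \<Longrightarrow>
          \<forall>\<^sub>F i in sequentially. (f ^^ n) u \<preceq> (\<delta> * exp (a (N i))) *\<^sub>R (f ^^ N i) u"
        using orbit_negligible[OF u records[unfolded a_def] unbounded[unfolded a_def]
            mono lim K K_nonneg \<delta>, folded a_def] by blast
      have "\<forall>\<^sub>F j in sequentially. norm ((f ^^ q j) x - z) < e * (\<epsilon> / 2)"
        using tendstoD[OF q(2), of "e * (\<epsilon> / 2)"] e(1) \<epsilon> by (simp add: dist_norm)
      then have "\<forall>\<^sub>F j in sequentially. norm ((f ^^ q j) x - z) < e * (\<epsilon> / 2) \<and> j \<ge> k"
        using eventually_ge_at_top[of k] by (rule eventually_conj)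
      then obtain j where j: "norm ((f ^^ q j) x - z) < e * (\<epsilon> / 2)" "j \<ge> k"
        by (auto simp: eventually_sequentially)
      define n where "n = q j"
      have n: "n \<ge> k" using j(2) seq_suble[OF q(1), of j] by (simp add: n_def)
      \<comment> \<open>The error \<open>(\<epsilon> / 2) u\<close> is harmless, as \<open>u \<preceq> y i\<close> for every \<open>i\<close>.\<close>
      have "z - (f ^^ n) x \<preceq> (\<epsilon> / 2) *\<^sub>R u"
        using j(1) \<epsilon> by (intro e(2)) (auto simp: n_def norm_minus_commute)
      then have 1: "z \<preceq> (f ^^ n) x + (\<epsilon> / 2) *\<^sub>R u" by (simp add: cone_le_def algebra_simps)
      have 2: "(f ^^ n) x \<preceq> R *\<^sub>R (f ^^ n) u"
        using thompson_le_iff[OF funpow_interior[OF x] funpow_interior[OF u]]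
          funpow_nonexpansive[OF x u] by (auto simp: R_def)
      show ?thesis
        using k[OF n]
      proof eventually_elim
        case (elim i)
        have "R *\<^sub>R (f ^^ n) u \<preceq> R *\<^sub>R (\<delta> *\<^sub>R y i)"
          using elim R by (intro le_scaleR_mono) (auto simp: y_def)
        with 2 have "(f ^^ n) x \<preceq> R *\<^sub>R (\<delta> *\<^sub>R y i)" by (rule le_trans)
        moreover have "R *\<^sub>R (\<delta> *\<^sub>R y i) = (\<epsilon> / 2) *\<^sub>R y i" using R by (simp add: \<delta>_def)
        moreover have "(\<epsilon> / 2) *\<^sub>R u \<preceq> (\<epsilon> / 2) *\<^sub>R y i"
          using uy \<epsilon> by (intro le_scaleR_mono) auto
        ultimately have "(f ^^ n) x + (\<epsilon> / 2) *\<^sub>R u \<preceq> (\<epsilon> / 2) *\<^sub>R y i + (\<epsilon> / 2) *\<^sub>R y i"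
          using le_add_mono by metis
        with 1 have "z \<preceq> (\<epsilon> / 2) *\<^sub>R y i + (\<epsilon> / 2) *\<^sub>R y i" by (rule le_trans)
        then show ?case by (simp flip: scaleR_add_left)
      qed
    qed
    ultimately show "z \<in> \<Omega>" by (simp add: \<Omega>_def)
  qed
  ultimately show ?thesis by blast
qed

end

lemma ordering_cone_zero_interior_imp_trivial:
  fixes C :: "'a::real_normed_vector set" and x :: 'a
  assumes C: "ordering_cone C" and "0 \<in> interior C"
  shows "x = 0"
proof -
  obtain e where e: "e > 0" "cball 0 e \<subseteq> C" using assms(2) mem_interior_cball by metis
  define t where "t = e / (norm x + 1)"
  have t: "t > 0" using e(1) by (simp add: t_def add_nonneg_pos)
  have "norm x + 1 \<noteq> 0" using norm_ge_zero[of x] by linarith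
  then have "t * (norm x + 1) = e" by (simp add: t_def)
  then have "norm (t *\<^sub>R x) \<le> e" using t by (simp add: distrib_left)
  then have "t *\<^sub>R x \<in> cball 0 e" "- (t *\<^sub>R x) \<in> cball 0 e" by (simp_all add: dist_norm)
  then have "t *\<^sub>R x \<in> C" "- (t *\<^sub>R x) \<in> C" using e(2) by blast+
  then have "t *\<^sub>R x = 0" by (rule ordering_coneD(4)[OF C])
  with t show ?thesis by simp
qed

theorem theorem3p2:
  fixes C :: "'a::banach set" and f :: "'a \<Rightarrow> 'a" and x\<^sub>0 :: 'a
  assumes "ordering_cone C"
    and "closed C"
    and "normal_cone C"
    and "interior C \<noteq> {}"
    and "f \<in> interior C \<rightarrow> interior C"
    and "\<forall>x\<in>interior C. f x \<noteq> x"
    and "thompson_nonexpansive C f"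
    and "thompson_fpp C f"
    and "x\<^sub>0 \<in> interior C"
    and "compact (closure (orbit_set f x\<^sub>0))"
  shows "\<exists>\<Omega>. convex \<Omega> \<and> \<Omega> \<subseteq> frontier C \<and> (\<forall>x\<in>interior C. omega_limit_set f x \<subseteq> \<Omega>)"
proof -
  have "0 \<notin> interior C"
  proof
    assume "0 \<in> interior C"
    then have "f x\<^sub>0 = 0" "x\<^sub>0 = 0"
      using ordering_cone_zero_interior_imp_trivial[OF assms(1)] by blast+
    then show False using assms(6,9) by auto
  qed
  then interpret thompson_nonexpansive_map C f
    using assms by unfold_locales
  show ?thesis
    using omega_limit_sets_in_convex_boundary_set assms by blast
qed

end
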